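(* Let $\delta_0$ be the unique positive solution of $\frac{x}{2}(1+x)^{3/2}(3+x)\left[1+(1+x)^{3/2}\right]=1$, $x>0$. For $\delta\in[0,\delta_0)$ let $\Phi_\delta$ denote the unique solution in $K$ of the boundary value problem $$[(1+\delta y(x))y'(x)]'+2xy'(x)=0\quad (0<x<+\infty),\qquad y(0)=0,\qquad y(+\infty)=1.$$ Then $\Phi_\delta$ converges uniformly to the classical error function as $\delta\to0^+$, i.e. $$\|\Phi_\delta-\operatorname{erf}\|_\infty\to 0\quad\text{when }\delta\to 0^+ .$$
   Context: $K$ is the set of all non-negative (real) analytic functions on $\mathbb{R}_0^+=[0,+\infty)$ which are bounded by $1$. $\|\cdot\|_\infty$ is the supremum norm on $\mathbb{R}_0^+$. The condition $y(+\infty)=1$ means $\lim_{x\to+\infty}y(x)=1$. The error function is $\operatorname{erf}(x)=\frac{2}{\sqrt\pi}\int_0^x\exp(-\xi^2)\,d\xi$. Known fact (from earlier work) making $\Phi_\delta$ well defined: for every $0\le\delta<\delta_0$ the boundary value problem has a unique solution $\Phi_\delta$ in $K$, and $\Phi_\delta$ is the unique fixed point of the operator $\tau_\delta:K\to K$ given by $$\tau_\delta(h)(x)=C_{\delta,h}\int_0^x\frac{1}{1+\delta h(\eta)}\exp\left(-2\int_0^\eta\frac{\xi}{1+\delta h(\xi)}d\xi\right)d\eta,\quad x\ge 0,$$ where $$C_{\delta,h}=\left(\int_0^{+\infty}\frac{1}{1+\delta h(\eta)}\exp\left(-2\int_0^\eta\frac{\xi}{1+\delta h(\xi)}d\xi\right)d\eta\right)^{-1}.$$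 The function $\Phi_\delta$ is called the modified error function. *)

theory Defs
  imports "HOL-Analysis.Analysis"
begin

text \<open>
  Functions on the half-line are represented by functions on all reals whose values at negative
  arguments are never inspected.
\<close>

text \<open>
  At a point of \<open>S\<close> that is not interior (here: the point 0 of the half-line), the
  power series is only required to represent \<open>f\<close> at the nearby points of \<open>S\<close>.
\<close>

definition real_analytic_on :: "(real \<Rightarrow> real) \<Rightarrow> real set \<Rightarrow> bool" where
  "real_analytic_on f S \<longleftrightarrow>
     (\<forall>x\<in>S. \<exists>a r. r > 0 \<and> (\<forall>y\<in>S. \<bar>y - x\<bar> < r \<longrightarrow> (\<lambda>n. a n * (y - x) ^ n) sums f y))"

definition K :: "(real \<Rightarrow> real) set" where
  "K = {h. real_analytic_on h {0..} \<and> (\<forall>x\<ge>0. 0 \<le> h x \<and> h x \<le> 1)}"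

definition solves_bvp :: "real \<Rightarrow> (real \<Rightarrow> real) \<Rightarrow> bool" where
  "solves_bvp \<delta> y \<longleftrightarrow>
     (\<forall>x>0. y differentiable (at x) \<and>
            (\<lambda>t. (1 + \<delta> * y t) * deriv y t) differentiable (at x) \<and>
            deriv (\<lambda>t. (1 + \<delta> * y t) * deriv y t) x + 2 * x * deriv y x = 0) \<and>
     y 0 = 0 \<and>
     (y \<longlongrightarrow> 1) at_top"

text \<open>Uniqueness means equality on the half-line.\<close>

definition unique_solution_in_K :: "real \<Rightarrow> (real \<Rightarrow> real) \<Rightarrow> bool" where
  "unique_solution_in_K \<delta> y \<longleftrightarrow>
     y \<in> K \<and> solves_bvp \<delta> y \<and>
     (\<forall>z\<in>K. solves_bvp \<delta> z \<longrightarrow> (\<forall>x\<ge>0. z x = y x))"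

definition erf :: "real \<Rightarrow> real" where
  "erf x = 2 / sqrt pi * integral {0..x} (\<lambda>\<xi>. exp (- (\<xi>\<^sup>2)))"

text \<open>Meaningful for functions that are bounded on the half-line.\<close>

definition sup_norm :: "(real \<Rightarrow> real) \<Rightarrow> real" where
  "sup_norm f = (SUP x\<in>{0..}. \<bar>f x\<bar>)"

definition delta0_equation :: "real \<Rightarrow> bool" where
  "delta0_equation x \<longleftrightarrow>
     x / 2 * (1 + x) powr (3/2) * (3 + x) * (1 + (1 + x) powr (3/2)) = 1"

definition delta0 :: real where
  "delta0 = (THE x. x > 0 \<and> delta0_equation x)"

lemma delta0_ex1: "\<exists>!x. x > 0 \<and> delta0_equation x"
proof -
  let ?g = "\<lambda>x::real. x / 2 * (1 + x) powr (3/2) * (3 + x) * (1 + (1 + x) powr (3/2))"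
  have mono: "?g x < ?g y" if "0 < x" "x < y" for x y
  proof -
    have p: "(1 + x) powr (3/2) < (1 + y) powr (3/2)"
      using that by (intro powr_less_mono2) auto
    have q: "0 < (1 + x) powr (3/2)" using that by simp
    show ?thesis
      using that p q by (intro mult_strict_mono) auto
  qed
  have one: "1 \<le> ?g 1"
  proof -
    have "(2::real) powr (3/2) \<ge> 2 powr 0" by (intro powr_mono) auto
    then have a: "(2::real) powr (3/2) \<ge> 1" by simp
    then have "1 * 1 \<le> (2::real) powr (3/2) * (1 + 2 powr (3/2))"
      by (intro mult_mono) auto
    then show ?thesis by simp
  qed
  have cont: "continuous_on {0..1} ?g"
    by (intro continuous_intros) auto
  have "\<exists>x\<ge>0. x \<le> 1 \<and> ?g x = 1"
    by (rule IVT'[OF _ one _ cont]) auto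
  then obtain x where x: "x \<ge> 0" "?g x = 1" by blast
  have "x \<noteq> 0" using x(2) by auto
  with x have "x > 0 \<and> delta0_equation x" by (simp add: delta0_equation_def)
  moreover have "y = x" if "y > 0 \<and> delta0_equation y" for y
    using that calculation mono[of x y] mono[of y x]
    unfolding delta0_equation_def by (cases x y rule: linorder_cases) auto
  ultimately show ?thesis by blast
qed

end

theory Submission
  imports Defs "HOL-Probability.Distributions"
begin

text \<open>
  For a solution \<open>y\<close> in \<open>K\<close> put \<open>w = (1 + \<delta> y) y'\<close>, so that
  \<open>w' = - 2 x w / (1 + \<delta> y)\<close>. Since \<open>0 \<le> y \<le> 1\<close>, the function \<open>w\<close> is non-negative,
  \<open>w(x) exp(x\<^sup>2)\<close> is non-decreasing and \<open>w(x) exp(x\<^sup>2 / (1 + \<delta>))\<close> is non-increasing. Hence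
  \<open>y'\<close> lies between multiples of two Gaussians; integrating, and eliminating the multiplicative
  constant (read off at a point \<open>a > 0\<close>, with \<open>a \<rightarrow> 0\<close> afterwards) by means of \<open>y(+\<infinity>) = erf(+\<infinity>) = 1\<close>, one gets
  \<open>(1 + \<delta>)\<^bsup>-3/2\<^esup> erf(x) \<le> y(x) \<le> (1 + \<delta>)\<^bsup>3/2\<^esup> erf(x)\<close>.
\<close>

section \<open>The error function on the half-line\<close>

lemma erf_0 [simp]: "erf 0 = 0"
  by (simp add: erf_def)

lemma DERIV_erf:
  assumes "x > 0"
  shows "(erf has_real_derivative 2 / sqrt pi * exp (- x\<^sup>2)) (at x)"
proof -
  \<comment> \<open>The interval runs past \<open>x\<close> so that \<open>x\<close> is interior and
    the one-sided derivative is a full one.\<close>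
  have "((\<lambda>t. integral {0..t} (\<lambda>\<xi>. exp (- (\<xi>\<^sup>2)))) has_real_derivative exp (- x\<^sup>2))
          (at x within {0..x + 1})"
    using assms by (intro integral_has_real_derivative continuous_intros) auto
  moreover have "at x within {0..x + 1} = at x"
    using assms by (intro at_within_interior) auto
  ultimately show ?thesis
    unfolding erf_def[abs_def] by (intro DERIV_cmult) simp
qed

lemma erf_tendsto_0: "(erf \<longlongrightarrow> 0) (at_right 0)"
proof -
  have "((\<lambda>t. integral {0..t} (\<lambda>\<xi>. exp (- (\<xi>\<^sup>2)))) has_real_derivative exp (- 0\<^sup>2))
          (at 0 within {0..1::real})"
    by (intro integral_has_real_derivative continuous_intros) auto
  then have "((\<lambda>t. integral {0..t} (\<lambda>\<xi>. exp (- (\<xi>\<^sup>2)))) \<longlongrightarrow> 0) (at 0 within {0..1::real})"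
    using DERIV_continuous[unfolded continuous_within] by fastforce
  then have "(erf \<longlongrightarrow> 2 / sqrt pi * 0) (at 0 within {0..1})"
    unfolding erf_def[abs_def] by (intro tendsto_intros)
  then show ?thesis
    by (simp add: at_within_Icc_at_right)
qed

lemma erf_mono:
  assumes "0 \<le> x" "x \<le> y"
  shows "erf x \<le> erf y"
  unfolding erf_def
  using assms by (intro mult_left_mono integral_subset_le integrable_continuous_interval
      continuous_intros) auto

text \<open>The half-line Gaussian integral \<open>sqrt pi / 2\<close> is a Lebesgue integral; its
  truncations at \<open>y\<close> are identified with the gauge integrals that define
  \<open>erf\<close>.\<close>

lemma erf_tendsto_1: "(erf \<longlongrightarrow> 1) at_top"
proof -
  let ?f = "\<lambda>x. indicator {0..} x *\<^sub>R exp (- x\<^sup>2) :: real"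
  have int: "integrable lborel ?f" and val: "integral\<^sup>L lborel ?f = sqrt pi / 2"
    using gaussian_moment_0 by (auto simp: has_bochner_integral_iff)
  have "((\<lambda>y. \<integral> x. indicator {.. y} x *\<^sub>R ?f x \<partial>lborel) \<longlongrightarrow> sqrt pi / 2) at_top"
    using tendsto_integral_at_top[OF _ int] unfolding val by simp
  moreover have "(\<integral> x. indicator {.. y} x *\<^sub>R ?f x \<partial>lborel) = integral {0..y} (\<lambda>x. exp (- x\<^sup>2))" for y
  proof -
    have "(\<integral> x. indicator {.. y} x *\<^sub>R ?f x \<partial>lborel) = (LINT x:{0..y}|lborel. exp (- x\<^sup>2))"
      unfolding set_lebesgue_integral_def
      by (intro Bochner_Integration.integral_cong) (auto simp: indicator_def)
    also have "\<dots> = integral {0..y} (\<lambda>x. exp (- x\<^sup>2))"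
      by (intro set_borel_integral_eq_integral borel_integrable_atLeastAtMost')
        (intro continuous_intros)
    finally show ?thesis .
  qed
  ultimately have "((\<lambda>y. 2 / sqrt pi * integral {0..y} (\<lambda>x. exp (- x\<^sup>2))) \<longlongrightarrow> 2 / sqrt pi * (sqrt pi / 2)) at_top"
    by (intro tendsto_intros) simp
  then show ?thesis
    unfolding erf_def[abs_def] by simp
qed

lemma erf_le_1: "0 \<le> x \<Longrightarrow> erf x \<le> 1"
  by (rule tendsto_lowerbound[OF erf_tendsto_1])
    (auto intro: erf_mono eventually_mono[OF eventually_ge_at_top[of x]])

text \<open>To the right of 0 the function is the sum of a power series converging at
  \<open>r / 2\<close>, hence continuous at 0. This ties the boundary value \<open>y 0 = 0\<close>
  to the equation, which holds only for \<open>x > 0\<close>.\<close>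

lemma real_analytic_on_tendsto_at_right:
  assumes "real_analytic_on f {0..}"
  shows "(f \<longlongrightarrow> f 0) (at_right 0)"
proof -
  have "\<exists>a r. r > 0 \<and> (\<forall>y\<in>{0..}. \<bar>y - 0\<bar> < r \<longrightarrow> (\<lambda>n. a n * (y - 0) ^ n) sums f y)"
    using assms unfolding real_analytic_on_def by (rule bspec) simp
  then obtain a r where r: "r > 0" "\<And>y. 0 \<le> y \<Longrightarrow> y < r \<Longrightarrow> (\<lambda>n. a n * y ^ n) sums f y"
    by auto
  have "summable (\<lambda>n. a n * (r / 2) ^ n)"
    using r(2)[of "r / 2"] r(1) by (auto simp: sums_iff)
  then have "isCont (\<lambda>x. \<Sum>n. a n * x ^ n) 0"
    using r(1) by (intro isCont_powser[of a "r / 2"]) auto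
  then have "((\<lambda>x. \<Sum>n. a n * x ^ n) \<longlongrightarrow> (\<Sum>n. a n * 0 ^ n)) (at_right 0)"
    unfolding isCont_def by (rule filterlim_mono) (auto simp: at_within_le_at)
  moreover have "\<forall>\<^sub>F x in at_right 0. (\<Sum>n. a n * x ^ n) = f x"
    using r(1) unfolding eventually_at_right_field
    by (intro exI[of _ r]) (simp add: sums_unique[OF r(2), symmetric])
  moreover have "(\<Sum>n. a n * 0 ^ n) = f 0"
    using r(2)[of 0] r(1) by (simp add: sums_iff)
  ultimately show ?thesis
    by (simp add: tendsto_cong)
qed

section \<open>Elementary facts about one solution\<close>

locale bvp_solution =
  fixes \<delta> :: real and y :: "real \<Rightarrow> real"
  assumes pos: "0 < \<delta>" and in_K: "y \<in> K" and solves: "solves_bvp \<delta> y"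
begin

definition w :: "real \<Rightarrow> real" where
  "w t = (1 + \<delta> * y t) * deriv y t"

text \<open>The width of the wider Gaussian: \<open>exp (- (x / s)\<^sup>2)\<close> is
  \<open>exp (- x\<^sup>2 / (1 + \<delta>))\<close>.\<close>

abbreviation s :: real where
  "s \<equiv> sqrt (1 + \<delta>)"

lemma s_pos: "0 < s" and s_cube: "s ^ 3 = s * (1 + \<delta>)"
  using pos by (auto simp: power3_eq_cube)

lemma bounds: "0 \<le> x \<Longrightarrow> 0 \<le> y x" "0 \<le> x \<Longrightarrow> y x \<le> 1"
  using in_K by (auto simp: K_def)

lemma y_at_top: "(y \<longlongrightarrow> 1) at_top"
  using solves by (simp add: solves_bvp_def)

lemma y_at_0: "(y \<longlongrightarrow> 0) (at_right 0)"
  using real_analytic_on_tendsto_at_right[of y] in_K solves by (simp add: K_def solves_bvp_def)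

lemma DERIV_y: "x > 0 \<Longrightarrow> (y has_real_derivative deriv y x) (at x)"
  using solves by (auto simp: solves_bvp_def DERIV_deriv_iff_real_differentiable)

lemma coeff_ge: "0 \<le> x \<Longrightarrow> 1 \<le> 1 + \<delta> * y x"
  using bounds pos by simp

lemma coeff_le: "0 \<le> x \<Longrightarrow> 1 + \<delta> * y x \<le> 1 + \<delta>"
  using bounds pos by (simp add: mult_left_le)

lemma DERIV_w: "x > 0 \<Longrightarrow> (w has_real_derivative - 2 * x * deriv y x) (at x)"
proof -
  assume "x > 0"
  then have "w differentiable at x" and "deriv w x = - 2 * x * deriv y x"
    using solves by (auto simp: solves_bvp_def w_def[abs_def] add_eq_0_iff)
  then show ?thesis
    by (metis DERIV_deriv_iff_real_differentiable)
qed

section \<open>The sign of the derivative\<close>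

text \<open>Squaring makes the sign of the derivative of
  \<open>(w t)\<^sup>2 * exp (2 * t\<^sup>2)\<close> independent of the sign of \<open>w\<close>,
  which is still unknown here.\<close>

lemma w_nonzero_mono:
  assumes "0 < a" "a \<le> x" "w a \<noteq> 0"
  shows "w x \<noteq> 0"
proof -
  have "(w a)\<^sup>2 * exp (2 * a\<^sup>2) \<le> (w x)\<^sup>2 * exp (2 * x\<^sup>2)"
    using assms(2)
  proof (rule DERIV_nonneg_imp_nondecreasing)
    fix t assume "a \<le> t" "t \<le> x"
    with assms have t: "t > 0" by simp
    let ?q = "1 + \<delta> * y t" and ?d = "deriv y t"
    have "((\<lambda>t. (w t)\<^sup>2 * exp (2 * t\<^sup>2)) has_real_derivative
        4 * t * exp (2 * t\<^sup>2) * (?q * ?d\<^sup>2 * (?q - 1))) (at t)"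
      by (rule derivative_eq_intros DERIV_w[OF t] refl)+
        (simp add: w_def algebra_simps power2_eq_square)
    moreover have "0 \<le> 4 * t * exp (2 * t\<^sup>2) * (?q * ?d\<^sup>2 * (?q - 1))"
      using t coeff_ge[of t] by (intro mult_nonneg_nonneg) auto
    ultimately show "\<exists>d. ((\<lambda>t. (w t)\<^sup>2 * exp (2 * t\<^sup>2)) has_real_derivative d) (at t) \<and> 0 \<le> d"
      by blast
  qed
  moreover have "0 < (w a)\<^sup>2 * exp (2 * a\<^sup>2)"
    using assms by simp
  ultimately have "0 < (w x)\<^sup>2 * exp (2 * x\<^sup>2)"
    by linarith
  then show ?thesis
    by auto
qed

text \<open>If \<open>w\<close> were negative somewhere, it would stay negative from there on, and \<open>y\<close> would
  approach its limit 1 strictly from above.\<close>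

lemma deriv_y_nonneg:
  assumes "x > 0"
  shows "0 \<le> deriv y x"
proof (rule ccontr)
  assume "\<not> 0 \<le> deriv y x"
  then have neg: "w x < 0"
    using coeff_ge[of x] assms by (simp add: w_def mult_less_0_iff)
  have stays: "deriv y t < 0" if xt: "x \<le> t" for t
  proof -
    have "w t < 0"
    proof (rule ccontr)
      assume "\<not> w t < 0"
      moreover have "continuous_on {x..t} w"
        using assms by (intro DERIV_continuous_on[OF has_field_derivative_at_within[OF DERIV_w]]) auto
      ultimately obtain u where "x \<le> u" "w u = 0"
        using IVT'[of w x 0 t] neg xt by force
      then show False
        using w_nonzero_mono[of x u] assms neg by auto
    qed
    then show ?thesis
      using coeff_ge[of t] assms that by (simp add: w_def mult_less_0_iff)
  qed
  have anti: "y b < y a" if "x \<le> a" "a < b" for a b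
    using that(2)
  proof (rule DERIV_neg_imp_decreasing)
    fix t assume "a \<le> t" "t \<le> b"
    then show "\<exists>d. (y has_real_derivative d) (at t) \<and> d < 0"
      using DERIV_y[of t] stays[of t] assms that by auto
  qed
  \<comment> \<open>The unit step leaves room for the strict inequality
    \<open>y x > y (x + 1)\<close>, which contradicts \<open>y x \<le> 1\<close>.\<close>
  have "1 \<le> y (x + 1)"
    by (rule tendsto_upperbound[OF y_at_top])
      (auto intro!: eventually_mono[OF eventually_gt_at_top[of "x + 1"]] less_imp_le anti)
  then show False
    using anti[of x "x + 1"] bounds(2)[of x] assms by simp
qed

lemma w_nonneg: "0 < x \<Longrightarrow> 0 \<le> w x"
  unfolding w_def using coeff_ge[of x] deriv_y_nonneg[of x] by (intro mult_nonneg_nonneg) auto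

section \<open>Gaussian bounds for \<open>w\<close>\<close>

text \<open>The exponent belongs to the coefficient \<open>1 + \<delta> * y\<close> frozen at its
  lower bound 1.\<close>

lemma w_lower:
  assumes "0 < a" "a \<le> x"
  shows "w a * exp (a\<^sup>2) \<le> w x * exp (x\<^sup>2)"
  using assms(2)
proof (rule DERIV_nonneg_imp_nondecreasing)
  fix t assume "a \<le> t" "t \<le> x"
  with assms have t: "t > 0" by simp
  let ?q = "1 + \<delta> * y t"
  have "((\<lambda>t. w t * exp (t\<^sup>2)) has_real_derivative
      2 * t * exp (t\<^sup>2) * (deriv y t * (?q - 1))) (at t)"
    by (rule derivative_eq_intros DERIV_w[OF t] refl)+ (simp add: w_def algebra_simps)
  moreover have "0 \<le> 2 * t * exp (t\<^sup>2) * (deriv y t * (?q - 1))"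
    using t coeff_ge[of t] deriv_y_nonneg[OF t] by (intro mult_nonneg_nonneg) auto
  ultimately show "\<exists>d. ((\<lambda>t. w t * exp (t\<^sup>2)) has_real_derivative d) (at t) \<and> 0 \<le> d"
    by blast
qed

text \<open>Here the coefficient is frozen at its upper bound \<open>1 + \<delta>\<close>, which
  reverses the sign of the derivative.\<close>

lemma w_upper:
  assumes "0 < a" "a \<le> x"
  shows "w x * exp (x\<^sup>2 / (1 + \<delta>)) \<le> w a * exp (a\<^sup>2 / (1 + \<delta>))"
  using assms(2)
proof (rule DERIV_nonpos_imp_nonincreasing)
  fix t assume "a \<le> t" "t \<le> x"
  with assms have t: "t > 0" by simp
  let ?q = "1 + \<delta> * y t"
  have "((\<lambda>t. exp (t\<^sup>2 / (1 + \<delta>))) has_real_derivative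
      exp (t\<^sup>2 / (1 + \<delta>)) * (2 * t / (1 + \<delta>))) (at t)"
    using pos by (auto intro!: derivative_eq_intros)
  from DERIV_mult[OF DERIV_w[OF t] this]
  have "((\<lambda>t. w t * exp (t\<^sup>2 / (1 + \<delta>))) has_real_derivative
      2 * t * exp (t\<^sup>2 / (1 + \<delta>)) * (deriv y t * (?q / (1 + \<delta>) - 1))) (at t)"
    by (rule DERIV_cong) (simp add: w_def algebra_simps)
  moreover have "2 * t * exp (t\<^sup>2 / (1 + \<delta>)) * (deriv y t * (?q / (1 + \<delta>) - 1)) \<le> 0"
    using t coeff_le[of t] deriv_y_nonneg[OF t] pos
    by (intro mult_nonneg_nonpos) auto
  ultimately show "\<exists>d. ((\<lambda>t. w t * exp (t\<^sup>2 / (1 + \<delta>))) has_real_derivative d) (at t) \<and> d \<le> 0"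
    by blast
qed

text \<open>The scale of \<open>y'\<close> read off at \<open>a\<close>: for \<open>\<delta> = 0\<close> one would have \<open>y' = amp a \<cdot> erf'\<close>.\<close>

definition amp :: "real \<Rightarrow> real" where
  "amp a = sqrt pi / 2 * (w a * exp (a\<^sup>2))"

section \<open>Increments of \<open>y\<close> against those of \<open>erf\<close>\<close>

text \<open>Dividing \<open>w_lower\<close> by the coefficient, which is at most
  \<open>1 + \<delta>\<close>, bounds \<open>deriv y\<close> below by a multiple of the derivative
  of \<open>erf\<close>.\<close>

lemma increment_lower:
  assumes "0 < a" "a \<le> x"
  shows "amp a / (1 + \<delta>) * (erf x - erf a) \<le> y x - y a"
proof -
  have "y a - amp a / (1 + \<delta>) * erf a \<le> y x - amp a / (1 + \<delta>) * erf x"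
    using assms(2)
  proof (rule DERIV_nonneg_imp_nondecreasing)
    fix t assume t': "a \<le> t" "t \<le> x"
    with assms have t: "t > 0" by simp
    let ?D = "deriv y t - amp a / (1 + \<delta>) * (2 / sqrt pi * exp (- t\<^sup>2))"
    have "((\<lambda>t. y t - amp a / (1 + \<delta>) * erf t) has_real_derivative ?D) (at t)"
      by (intro DERIV_diff DERIV_y DERIV_cmult DERIV_erf t)
    moreover have "0 \<le> ?D"
    proof -
      have "w a * exp (a\<^sup>2) * exp (- t\<^sup>2) \<le> w t"
        using w_lower[OF assms(1) t'(1)] by (simp add: exp_minus field_simps)
      also have "\<dots> \<le> (1 + \<delta>) * deriv y t"
        unfolding w_def using coeff_le[of t] deriv_y_nonneg[OF t] t by (intro mult_right_mono) auto
      finally have "w a * exp (a\<^sup>2) * exp (- t\<^sup>2) / (1 + \<delta>) \<le> deriv y t"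
        using pos by (simp add: pos_divide_le_eq mult.commute)
      moreover have "amp a * (2 / sqrt pi * exp (- t\<^sup>2)) / (1 + \<delta>) =
          w a * exp (a\<^sup>2) * exp (- t\<^sup>2) / (1 + \<delta>)"
        by (simp add: amp_def)
      ultimately show ?thesis
        by (simp only: times_divide_eq_left diff_ge_0_iff_ge)
    qed
    ultimately show "\<exists>d. ((\<lambda>t. y t - amp a / (1 + \<delta>) * erf t) has_real_derivative d) (at t) \<and> 0 \<le> d"
      by blast
  qed
  then show ?thesis
    unfolding right_diff_distrib by linarith
qed

text \<open>Since the coefficient is at least 1, \<open>deriv y \<le> w\<close>, and
  \<open>w_upper\<close> bounds \<open>w\<close> by a Gaussian of width \<open>s\<close>;
  integrating it produces the factor \<open>s\<close>.\<close>

lemma increment_upper: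
  assumes "0 < a" "a \<le> x"
  shows "y x - y a \<le> amp a * s * (erf (x / s) - erf (a / s))"
proof -
  have s: "s > 0" "s\<^sup>2 = 1 + \<delta>" using pos by auto
  have "amp a * s * erf (a / s) - y a \<le> amp a * s * erf (x / s) - y x"
    using assms(2)
  proof (rule DERIV_nonneg_imp_nondecreasing)
    fix t assume t': "a \<le> t" "t \<le> x"
    with assms have t: "t > 0" by simp
    let ?D = "amp a * (2 / sqrt pi * exp (- (t / s)\<^sup>2)) - deriv y t"
    have "((\<lambda>t. erf (t / s)) has_real_derivative 2 / sqrt pi * exp (- (t / s)\<^sup>2) * (1 / s)) (at t)"
      using s t by (intro DERIV_chain2[OF DERIV_erf] DERIV_cdivide DERIV_ident) auto
    then have "((\<lambda>t. amp a * s * erf (t / s) - y t) has_real_derivative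
        amp a * s * (2 / sqrt pi * exp (- (t / s)\<^sup>2) * (1 / s)) - deriv y t) (at t)"
      by (intro DERIV_diff DERIV_y DERIV_cmult t)
    then have "((\<lambda>t. amp a * s * erf (t / s) - y t) has_real_derivative ?D) (at t)"
      using s(1) by (simp add: mult.assoc)
    moreover have "0 \<le> ?D"
    proof -
      have sq: "(t / s)\<^sup>2 = t\<^sup>2 / (1 + \<delta>)"
        by (simp add: power_divide s(2))
      have "deriv y t \<le> w t"
        using coeff_ge[of t] deriv_y_nonneg[OF t] t by (simp add: w_def mult_le_cancel_right1)
      also have "\<dots> \<le> w a * exp (a\<^sup>2 / (1 + \<delta>)) * exp (- (t / s)\<^sup>2)"
        using w_upper[OF assms(1) t'(1)] unfolding sq by (simp add: exp_minus field_simps)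
      \<comment> \<open>The constant is enlarged so that the same \<open>amp a\<close> governs both
        increment bounds and can be eliminated between them.\<close>
      also have "\<dots> \<le> w a * exp (a\<^sup>2) * exp (- (t / s)\<^sup>2)"
        using w_nonneg[OF assms(1)] pos
        by (intro mult_right_mono mult_left_mono mult_nonneg_nonneg)
          (auto simp: pos_divide_le_eq algebra_simps)
      also have "\<dots> = amp a * (2 / sqrt pi * exp (- (t / s)\<^sup>2))"
        by (simp add: amp_def)
      finally show ?thesis
        by simp
    qed
    ultimately show "\<exists>d. ((\<lambda>t. amp a * s * erf (t / s) - y t) has_real_derivative d) (at t) \<and> 0 \<le> d"
      by blast
  qed
  then show ?thesis
    by (simp add: algebra_simps)
qed

text \<open>Letting \<open>x\<close> tend to infinity in \<open>increment_lower\<close> turns the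
  limit 1 of \<open>y\<close> into a bound on the unknown amplitude; \<open>amp_lower\<close> does
  the same with \<open>increment_upper\<close>.\<close>

lemma amp_upper:
  assumes "0 < a"
  shows "amp a / (1 + \<delta>) * (1 - erf a) \<le> 1 - y a"
proof (rule tendsto_le[OF trivial_limit_at_top_linorder])
  show "((\<lambda>x. y x - y a) \<longlongrightarrow> 1 - y a) at_top"
    by (intro tendsto_intros y_at_top)
  show "((\<lambda>x. amp a / (1 + \<delta>) * (erf x - erf a)) \<longlongrightarrow> amp a / (1 + \<delta>) * (1 - erf a)) at_top"
    by (intro tendsto_intros erf_tendsto_1)
  show "\<forall>\<^sub>F x in at_top. amp a / (1 + \<delta>) * (erf x - erf a) \<le> y x - y a"
    using eventually_ge_at_top[of a] by eventually_elim (rule increment_lower[OF assms])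
qed

lemma amp_lower:
  assumes "0 < a"
  shows "1 - y a \<le> amp a * s * (1 - erf (a / s))"
proof (rule tendsto_le[OF trivial_limit_at_top_linorder])
  show "((\<lambda>x. y x - y a) \<longlongrightarrow> 1 - y a) at_top"
    by (intro tendsto_intros y_at_top)
  have "filterlim (\<lambda>x. x / s) at_top at_top"
    using pos filterlim_tendsto_pos_mult_at_top[OF tendsto_const[of "1 / s"] _ filterlim_ident]
    by simp
  then have "((\<lambda>x. erf (x / s)) \<longlongrightarrow> 1) at_top"
    by (rule filterlim_compose[OF erf_tendsto_1])
  then show "((\<lambda>x. amp a * s * (erf (x / s) - erf (a / s))) \<longlongrightarrow> amp a * s * (1 - erf (a / s))) at_top"
    by (intro tendsto_intros)
  show "\<forall>\<^sub>F x in at_top. y x - y a \<le> amp a * s * (erf (x / s) - erf (a / s))"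
    using eventually_ge_at_top[of a] by eventually_elim (rule increment_upper[OF assms])
qed

section \<open>Eliminating the amplitude and letting \<open>a\<close> tend to 0\<close>

lemma erf_scaled_tendsto_0: "((\<lambda>a. erf (a / s)) \<longlongrightarrow> 0) (at_right 0)"
proof (rule filterlim_compose[OF erf_tendsto_0])
  have "((\<lambda>a. a / s) \<longlongrightarrow> 0 / s) (at_right 0)"
    using pos by (intro tendsto_intros) auto
  then show "filterlim (\<lambda>a. a / s) (at_right 0) (at_right 0)"
    using pos by (auto simp: filterlim_at eventually_at_right_field intro!: exI[of _ 1])
qed

text \<open>\<open>amp_lower\<close> is combined with \<open>increment_lower\<close>. Multiplying
  the bounds avoids dividing by \<open>amp a\<close>, for which only non-negativity is at
  hand.\<close>

lemma y_ge:
  assumes "0 < x"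
  shows "erf x \<le> s ^ 3 * y x"
proof (rule tendsto_le[of "at_right 0"])
  show "((\<lambda>a. (1 - y a) * (erf x - erf a)) \<longlongrightarrow> erf x) (at_right 0)"
    by (auto intro!: tendsto_eq_intros y_at_0 erf_tendsto_0)
  show "((\<lambda>a. s ^ 3 * (1 - erf (a / s)) * (y x - y a)) \<longlongrightarrow> s ^ 3 * y x) (at_right 0)"
    by (auto intro!: tendsto_eq_intros y_at_0 erf_scaled_tendsto_0)
  have "(1 - y a) * (erf x - erf a) \<le> s ^ 3 * (1 - erf (a / s)) * (y x - y a)"
    if "0 < a" "a < x" for a
  proof -
    have "(1 - y a) * (erf x - erf a) \<le> amp a * s * (1 - erf (a / s)) * (erf x - erf a)"
      using amp_lower[OF that(1)] erf_mono[of a x] that by (intro mult_right_mono) auto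
    \<comment> \<open>The power 3/2 of \<open>1 + \<delta>\<close> arises here: a factor
      \<open>s\<close> from the Gaussian width and a factor \<open>1 + \<delta>\<close> from the
      coefficient.\<close>
    also have "\<dots> = s ^ 3 * (1 - erf (a / s)) * (amp a / (1 + \<delta>) * (erf x - erf a))"
      using pos by (simp add: s_cube)
    also have "\<dots> \<le> s ^ 3 * (1 - erf (a / s)) * (y x - y a)"
      using increment_lower[of a x] that erf_le_1[of "a / s"] s_pos by (intro mult_left_mono) auto
    finally show ?thesis .
  qed
  then show "\<forall>\<^sub>F a in at_right 0. (1 - y a) * (erf x - erf a) \<le> s ^ 3 * (1 - erf (a / s)) * (y x - y a)"
    using assms by (auto simp: eventually_at_right_field)
qed simp

text \<open>The mirror image: \<open>increment_upper\<close> is combined with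
  \<open>amp_upper\<close>.\<close>

lemma y_le:
  assumes "0 < x"
  shows "y x \<le> s ^ 3 * erf x"
proof -
  have "y x \<le> s ^ 3 * erf (x / s)"
  proof (rule tendsto_le[of "at_right 0"])
    show "((\<lambda>a. (1 - erf a) * (y x - y a)) \<longlongrightarrow> y x) (at_right 0)"
      by (auto intro!: tendsto_eq_intros y_at_0 erf_tendsto_0)
    show "((\<lambda>a. s ^ 3 * (1 - y a) * (erf (x / s) - erf (a / s))) \<longlongrightarrow> s ^ 3 * erf (x / s)) (at_right 0)"
      by (auto intro!: tendsto_eq_intros y_at_0 erf_scaled_tendsto_0)
    have "(1 - erf a) * (y x - y a) \<le> s ^ 3 * (1 - y a) * (erf (x / s) - erf (a / s))"
      if "0 < a" "a < x" for a
    proof -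
      have "(1 - erf a) * (y x - y a) \<le> (1 - erf a) * (amp a * s * (erf (x / s) - erf (a / s)))"
        using increment_upper[of a x] that erf_le_1[of a] by (intro mult_left_mono) auto
      also have "\<dots> = s ^ 3 * (amp a / (1 + \<delta>) * (1 - erf a)) * (erf (x / s) - erf (a / s))"
        using pos by (simp add: s_cube)
      also have "\<dots> \<le> s ^ 3 * (1 - y a) * (erf (x / s) - erf (a / s))"
        using amp_upper[OF that(1)] erf_mono[of "a / s" "x / s"] that s_pos
        by (intro mult_right_mono mult_left_mono) (auto simp: divide_right_mono)
      finally show ?thesis .
    qed
    then show "\<forall>\<^sub>F a in at_right 0. (1 - erf a) * (y x - y a) \<le> s ^ 3 * (1 - y a) * (erf (x / s) - erf (a / s))"
      using assms by (auto simp: eventually_at_right_field)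
  qed simp
  \<comment> \<open>The rescaling is dropped because \<open>s \<ge> 1\<close> and \<open>erf\<close>
    is non-decreasing.\<close>
  also have "\<dots> \<le> s ^ 3 * erf x"
    using assms pos by (intro mult_left_mono erf_mono) (auto simp: pos_divide_le_eq mult_le_cancel_left1)
  finally show ?thesis .
qed

text \<open>As \<open>y\<close> and \<open>erf\<close> are at most 1, a relative error
  \<open>s ^ 3 - 1\<close> is also an absolute one, uniform in \<open>x\<close>.\<close>

lemma dist_erf_le:
  assumes "0 \<le> x"
  shows "\<bar>y x - erf x\<bar> \<le> s ^ 3 - 1"
proof (cases "x = 0")
  case True
  then show ?thesis
    using solves pos by (simp add: solves_bvp_def)
next
  case False
  with assms have x: "x > 0" by simp
  have c: "0 \<le> s ^ 3 - 1"
    using pos by simp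
  have "y x - erf x \<le> (s ^ 3 - 1) * erf x"
    using y_le[OF x] by (simp add: algebra_simps)
  also have "\<dots> \<le> s ^ 3 - 1"
    using c erf_le_1[of x] assms by (simp add: mult_left_le)
  finally have 1: "y x - erf x \<le> s ^ 3 - 1" .
  have "erf x - y x \<le> (s ^ 3 - 1) * y x"
    using y_ge[OF x] by (simp add: algebra_simps)
  also have "\<dots> \<le> s ^ 3 - 1"
    using c bounds(2)[OF assms] by (simp add: mult_left_le)
  finally show ?thesis
    using 1 by simp
qed

end

section \<open>Passage to the supremum norm\<close>

lemma sup_norm_le:
  assumes "\<And>x. 0 \<le> x \<Longrightarrow> \<bar>f x\<bar> \<le> c"
  shows "\<bar>sup_norm f\<bar> \<le> c"
proof -
  have "bdd_above ((\<lambda>x. \<bar>f x\<bar>) ` {0..})"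
    using assms by (auto intro!: bdd_aboveI[of _ c])
  \<comment> \<open>The value at 0 shows that the supremum is non-negative, which disposes of the
    outer absolute value.\<close>
  then have "\<bar>f 0\<bar> \<le> sup_norm f"
    unfolding sup_norm_def by (intro cSUP_upper) auto
  moreover have "sup_norm f \<le> c"
    unfolding sup_norm_def using assms by (intro cSUP_least) auto
  ultimately show ?thesis
    by simp
qed

theorem mainTheorem2:
  fixes \<Phi> :: "real \<Rightarrow> real \<Rightarrow> real"
  assumes "\<And>\<delta>. 0 \<le> \<delta> \<Longrightarrow> \<delta> < delta0 \<Longrightarrow> unique_solution_in_K \<delta> (\<Phi> \<delta>)"
  shows "((\<lambda>\<delta>. sup_norm (\<lambda>x. \<Phi> \<delta> x - erf x)) \<longlongrightarrow> 0) (at_right 0)"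
proof (rule Lim_null_comparison)
  \<comment> \<open>Positivity makes \<open>\<Phi> \<delta>\<close> a solution for all
    \<open>\<delta>\<close> in a right neighbourhood of 0.\<close>
  have "delta0 > 0"
    using theI'[OF delta0_ex1] unfolding delta0_def by blast
  moreover have "norm (sup_norm (\<lambda>x. \<Phi> \<delta> x - erf x)) \<le> sqrt (1 + \<delta>) ^ 3 - 1"
    if "0 < \<delta>" "\<delta> < delta0" for \<delta>
  proof -
    interpret bvp_solution \<delta> "\<Phi> \<delta>"
      using assms[of \<delta>] that by unfold_locales (auto simp: unique_solution_in_K_def)
    show ?thesis
      using sup_norm_le[OF dist_erf_le] by simp
  qed
  ultimately show "\<forall>\<^sub>F \<delta> in at_right 0. norm (sup_norm (\<lambda>x. \<Phi> \<delta> x - erf x)) \<le> sqrt (1 + \<delta>) ^ 3 - 1"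
    by (auto simp: eventually_at_right_field)
  show "((\<lambda>\<delta>. sqrt (1 + \<delta>) ^ 3 - 1) \<longlongrightarrow> 0) (at_right 0)"
    by (auto intro!: tendsto_eq_intros)
qed

end
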